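(* Let $n\ge 1$ and let $T:\mathbb{H}^n\rightrightarrows V_1$ be an H-monotone map with $\mathrm{dom}(T)=\mathbb{H}^n$. Then the following two properties are equivalent: (i) $T$ is maximal H-monotone; (ii) for every $\eta\in\mathbb{H}^n$ and every $\lambda>0$, the set-valued map $(\xi_1+\lambda T)|_{H_\eta}:H_\eta\rightrightarrows V_1$ is surjective onto $V_1$, i.e. for every $p\in V_1$ there exists $\eta'\in H_\eta$ with $p\in \xi_1(\eta')+\lambda T(\eta')$.
   Context: The Heisenberg group $\mathbb{H}^n$ is $\mathbb{R}^n\times\mathbb{R}^n\times\mathbb{R}$ with group law $(x,y,t)\circ(x',y',t')=(x+x',y+y',t+t'+2(\langle x',y\rangle-\langle x,y'\rangle))$. $V_1\cong\mathbb{R}^{2n}$ is the first (horizontal) layer of its Lie algebra, with the Euclidean inner product $\langle\cdot,\cdot\rangle$ and norm, and $\xi_1:\mathbb{H}^n\to V_1$ is $\xi_1(x,y,t)=(x,y)$. For $\eta_0=(x_0,y_0,t_0)\in\mathbb{H}^n$ the horizontal plane through $\eta_0$ is $H_{\eta_0}=\{(x,y,t)\in\mathbb{H}^n: t=t_0+2(\langle y_0,x\rangle-\langle x_0,y\rangle)\}$. A set-valued map $T:\mathbb{H}^n\rightrightarrows V_1$ assigns to each $\eta$ a (possibly empty) subset $T(\eta)\subseteq V_1$; $\mathrm{dom}(T)=\{\eta: T(\eta)\ne\emptyset\}$ and $\mathrm{gr}(T)=\{(\eta,v): v\in T(\eta)\}$. A set $A\subset\mathbb{H}^n\times V_1$ is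 H-monotone if $\langle \xi_1(\eta)-\xi_1(\eta'),v-v'\rangle\ge 0$ for all $(\eta,v),(\eta',v')\in A$ with $\eta'\in H_\eta$; it is maximal H-monotone if it is H-monotone and is not properly contained in any H-monotone set. $T$ is (maximal) H-monotone if $\mathrm{gr}(T)$ is a (maximal) H-monotone set. *)

theory Defs
  imports "HOL-Analysis.Analysis"
begin

text \<open>
  The dimension \<open>n \<ge> 1\<close> is \<open>CARD('n)\<close>. The inner product and norm of the product type
  \<open>(real ^ 'n) \<times> (real ^ 'n)\<close> are the Euclidean ones of \<open>R^(2n)\<close>.
\<close>

type_synonym 'n heisenberg = "(real ^ 'n) \<times> (real ^ 'n) \<times> real"
type_synonym 'n layer1 = "(real ^ 'n) \<times> (real ^ 'n)"

definition heis_mult :: "'n::finite heisenberg \<Rightarrow> 'n heisenberg \<Rightarrow> 'n heisenberg"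
    (infixl "\<circ>\<^sub>H" 70) where
  "heis_mult = (\<lambda>(x, y, t) (x', y', t'). (x + x', y + y', t + t' + 2 * (x' \<bullet> y - x \<bullet> y')))"

definition xi1 :: "'n::finite heisenberg \<Rightarrow> 'n layer1" where
  "xi1 = (\<lambda>(x, y, t). (x, y))"

definition hplane :: "'n::finite heisenberg \<Rightarrow> 'n heisenberg set" where
  "hplane = (\<lambda>(x0, y0, t0). {(x, y, t). t = t0 + 2 * (y0 \<bullet> x - x0 \<bullet> y)})"

text \<open>The horizontal plane is the left translate of the horizontal layer.\<close>

lemma hplane_eq_translate:
  "hplane \<eta> = {\<eta> \<circ>\<^sub>H (x, y, 0) | x y. True}"
proof -
  obtain x0 y0 t0 where \<eta>: "\<eta> = (x0, y0, t0)"
    by (cases \<eta>)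
  have "(x, y, t0 + 2 * (y0 \<bullet> x - x0 \<bullet> y)) = \<eta> \<circ>\<^sub>H (x - x0, y - y0, 0)" for x y
    by (simp add: \<eta> heis_mult_def inner_diff_left inner_diff_right inner_commute)
  moreover have "\<eta> \<circ>\<^sub>H (x, y, 0) \<in> hplane \<eta>" for x y
    by (simp add: \<eta> heis_mult_def hplane_def inner_add_left inner_add_right inner_commute)
  ultimately show ?thesis
    by (fastforce simp: \<eta> hplane_def)
qed

definition smap_dom :: "('a \<Rightarrow> 'b set) \<Rightarrow> 'a set" where
  "smap_dom T = {\<eta>. T \<eta> \<noteq> {}}"

definition smap_graph :: "('a \<Rightarrow> 'b set) \<Rightarrow> ('a \<times> 'b) set" where
  "smap_graph T = {(\<eta>, v). v \<in> T \<eta>}"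

definition H_monotone_set :: "('n::finite heisenberg \<times> 'n layer1) set \<Rightarrow> bool" where
  "H_monotone_set A \<longleftrightarrow>
     (\<forall>(\<eta>, v)\<in>A. \<forall>(\<eta>', v')\<in>A. \<eta>' \<in> hplane \<eta> \<longrightarrow> (xi1 \<eta> - xi1 \<eta>') \<bullet> (v - v') \<ge> 0)"

definition maximal_H_monotone_set :: "('n::finite heisenberg \<times> 'n layer1) set \<Rightarrow> bool" where
  "maximal_H_monotone_set A \<longleftrightarrow> H_monotone_set A \<and> \<not> (\<exists>B. H_monotone_set B \<and> A \<subset> B)"

definition H_monotone :: "('n::finite heisenberg \<Rightarrow> 'n layer1 set) \<Rightarrow> bool" where
  "H_monotone T \<longleftrightarrow> H_monotone_set (smap_graph T)"

definition maximal_H_monotone :: "('n::finite heisenberg \<Rightarrow> 'n layer1 set) \<Rightarrow> bool" where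
  "maximal_H_monotone T \<longleftrightarrow> maximal_H_monotone_set (smap_graph T)"

definition xi1_plus ::
    "real \<Rightarrow> ('n::finite heisenberg \<Rightarrow> 'n layer1 set) \<Rightarrow> 'n heisenberg \<Rightarrow> 'n layer1 set" where
  "xi1_plus lam T \<eta> = {xi1 \<eta> + lam *\<^sub>R v | v. v \<in> T \<eta>}"

definition smap_surj_on :: "('a \<Rightarrow> 'b set) \<Rightarrow> 'a set \<Rightarrow> bool" where
  "smap_surj_on F S \<longleftrightarrow> (\<forall>p. \<exists>\<eta>'\<in>S. p \<in> F \<eta>')"

end

theory Submission
  imports Defs
begin

text \<open>
  As in Minty's theorem, surjectivity of \<open>\<xi>\<^sub>1 + T\<close> on the planes forces a point that is
  monotonically related to the graph to lie on it. For the converse, \<open>T\<close> restricted to a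
  horizontal plane \<open>H\<close> need not be monotone, as two points of \<open>H\<close> need not be
  horizontally related; only the pairs containing the centre of \<open>H\<close> are, and they give
  coercivity. Together with Brouwer's theorem this produces a point \<open>\<eta>'\<close> of \<open>H\<close> near
  which no direction separates the values of \<open>\<xi>\<^sub>1 + \<lambda>T - p\<close> from 0. Limits of
  monotonicity inequalities, taken through intermediate points that are horizontally related to
  both ends, then show that \<open>(p - \<xi>\<^sub>1 \<eta>') / \<lambda>\<close> is monotonically related to the graph, and
  maximality puts it in \<open>T \<eta>'\<close>.
\<close>

section \<open>A separation form of Brouwer's theorem for discontinuous fields\<close>

text \<open>If the claim failed throughout the ball, local separating directions would patch to a
  continuous field pairing positively with \<open>f\<close>. Its variational inequality on the ball
  has a solution, necessarily on the sphere, and there \<open>f\<close> would point strictly inward,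
  against \<open>sph\<close>.\<close>

lemma brouwer_separation:
  fixes f :: "'a::euclidean_space \<Rightarrow> 'a"
  assumes R: "R > 0" and sph: "\<And>z. dist z0 z = R \<Longrightarrow> (z - z0) \<bullet> f z \<ge> 0"
  obtains z where "z \<in> cball z0 R" "\<And>u e. e > 0 \<Longrightarrow> \<exists>z'\<in>ball z e. u \<bullet> f z' \<le> 0"
proof (rule ccontr)
  assume "\<not> thesis"
  then have "\<forall>z\<in>cball z0 R. \<exists>u e. e > 0 \<and> (\<forall>z'\<in>ball z e. u \<bullet> f z' > 0)"
    using that by (meson linorder_not_le)
  then obtain u e where e: "\<And>z. z \<in> cball z0 R \<Longrightarrow> e z > 0"
    and u: "\<And>z z'. z \<in> cball z0 R \<Longrightarrow> z' \<in> ball z (e z) \<Longrightarrow> u z \<bullet> f z' > 0"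
    by metis
  obtain D where D: "D \<subseteq> cball z0 R" "finite D" "cball z0 R \<subseteq> (\<Union>d\<in>D. ball d (e d))"
  proof (rule compactE_image[OF compact_cball[of z0 R], of "cball z0 R" "\<lambda>d. ball d (e d)"])
    show "cball z0 R \<subseteq> (\<Union>d\<in>cball z0 R. ball d (e d))"
      using e by fastforce
  qed (use that in auto)
  \<comment> \<open>Glue the separating directions, not the values of \<open>f\<close>: the field \<open>g\<close> is continuous although \<open>f\<close> is arbitrary.\<close>
  define g where "g z = (\<Sum>d\<in>D. max 0 (e d - dist d z) *\<^sub>R u d)" for z
  have g_pos: "g z \<bullet> f z > 0" if z: "z \<in> cball z0 R" for z
  proof -
    obtain d where d: "d \<in> D" "z \<in> ball d (e d)"
      using D(3) z by blast
    have "(\<Sum>d\<in>D. max 0 (e d - dist d z) * (u d \<bullet> f z)) > 0"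
    proof (rule sum_pos2[OF D(2) d(1)])
      show "0 < max 0 (e d - dist d z) * (u d \<bullet> f z)"
        using u[of d z] d D(1) by auto
      show "0 \<le> max 0 (e i - dist i z) * (u i \<bullet> f z)" if "i \<in> D" for i
        using u[of i z] that D(1) by (cases "z \<in> ball i (e i)") (auto simp: less_imp_le subset_iff)
    qed
    then show ?thesis
      by (simp add: g_def inner_sum_left)
  qed
  let ?P = "closest_point (cball z0 R)"
  have "continuous_on (cball z0 R) (\<lambda>z. ?P (z - g z))"
    by (rule continuous_on_compose2[OF continuous_on_closest_point[of "cball z0 R" UNIV]])
      (use R in \<open>auto simp: g_def intro!: continuous_intros\<close>)
  moreover have "(\<lambda>z. ?P (z - g z)) \<in> cball z0 R \<rightarrow> cball z0 R"
    using R closest_point_in_set[of "cball z0 R"] by auto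
  ultimately obtain z where z: "z \<in> cball z0 R" "?P (z - g z) = z"
    using brouwer[of "cball z0 R" "\<lambda>z. ?P (z - g z)"] R by auto
  \<comment> \<open>A fixed point of the projected step \<open>z - g z\<close> solves the
    variational inequality of \<open>g\<close> on the ball.\<close>
  have vi: "g z \<bullet> (x - z) \<ge> 0" if "x \<in> cball z0 R" for x
    using closest_point_dot[of "cball z0 R" x "z - g z"] that z(2) by simp
  have g0: "g z \<noteq> 0"
    using g_pos[OF z(1)] by auto
  \<comment> \<open>The test point minimizes the functional \<open>g z\<close> over the ball. This
    forces equality in Cauchy-Schwarz, so \<open>z\<close> is on the sphere and
    \<open>z0 - z\<close> is a positive multiple of \<open>g z\<close>.\<close>
  have "g z \<bullet> (z0 - (R / norm (g z)) *\<^sub>R g z - z) \<ge> 0"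
    by (rule vi) (use R g0 in \<open>auto simp: dist_norm\<close>)
  then have le: "R * norm (g z) \<le> g z \<bullet> (z0 - z)"
    using g0 by (simp add: inner_diff_right dot_square_norm power2_eq_square)
  also have "\<dots> \<le> norm (g z) * norm (z0 - z)"
    by (rule norm_cauchy_schwarz)
  finally have "R \<le> norm (z0 - z)"
    using g0 by simp
  with z(1) have eq: "norm (z0 - z) = R"
    by (simp add: dist_norm)
  with le norm_cauchy_schwarz[of "g z" "z0 - z"]
  have "norm (g z) *\<^sub>R (z0 - z) = R *\<^sub>R g z"
    using norm_cauchy_schwarz_eq[of "g z" "z0 - z"] by (simp add: mult.commute)
  then have "norm (g z) * ((z0 - z) \<bullet> f z) = R * (g z \<bullet> f z)"
    by (metis inner_scaleR_left)
  also have "\<dots> > 0"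
    using R g_pos[OF z(1)] by simp
  finally have "(z0 - z) \<bullet> f z > 0"
    using g0 by (simp add: zero_less_mult_iff)
  with sph[of z] eq show False
    by (simp add: dist_norm inner_diff_left)
qed

section \<open>Symplectic form and horizontal gaps\<close>

text \<open>The standard symplectic form up to sign, oriented so that the group law adds
  \<open>2 * omega z z'\<close> to the heights.\<close>

definition omega :: "'n::finite layer1 \<Rightarrow> 'n layer1 \<Rightarrow> real" where
  "omega z z' = snd z \<bullet> fst z' - fst z \<bullet> snd z'"

definition height :: "'n::finite heisenberg \<Rightarrow> real" where
  "height \<eta> = snd (snd \<eta>)"

definition heis_point :: "'n::finite layer1 \<Rightarrow> real \<Rightarrow> 'n heisenberg" where
  "heis_point z t = (fst z, snd z, t)"

text \<open>
  \<open>hgap \<eta> \<eta>'\<close> is the signed vertical distance from \<open>\<eta>'\<close> up to the horizontal plane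
  through \<open>\<eta>\<close>; it vanishes iff the points are horizontally related.
\<close>

definition hgap :: "'n::finite heisenberg \<Rightarrow> 'n heisenberg \<Rightarrow> real" where
  "hgap \<eta> \<eta>' = height \<eta> - height \<eta>' + 2 * omega (xi1 \<eta>) (xi1 \<eta>')"

text \<open>Multiplication by i under the identification of \<open>(x, y)\<close> with x + iy.
  Shifting a point along \<open>rot z\<close> changes its \<open>omega\<close> pairing with
  \<open>z\<close> by a controlled amount.\<close>

definition rot :: "'n::finite layer1 \<Rightarrow> 'n layer1" where
  "rot z = (- snd z, fst z)"

lemma xi1_heis_point [simp]: "xi1 (heis_point z t) = z"
  by (simp add: xi1_def heis_point_def)

lemma height_heis_point [simp]: "height (heis_point z t) = t"
  by (simp add: height_def heis_point_def)

lemma heis_point_xi1_height [simp]: "heis_point (xi1 \<eta>) (height \<eta>) = \<eta>"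
  by (simp add: xi1_def heis_point_def height_def split: prod.splits)

lemma omega_add_left: "omega (z + z') w = omega z w + omega z' w"
  and omega_add_right: "omega w (z + z') = omega w z + omega w z'"
  and omega_scaleR_left: "omega (c *\<^sub>R z) w = c * omega z w"
  and omega_scaleR_right: "omega w (c *\<^sub>R z) = c * omega w z"
  and omega_diff_left: "omega (z - z') w = omega z w - omega z' w"
  and omega_diff_right: "omega w (z - z') = omega w z - omega w z'"
  by (simp_all add: omega_def inner_simps algebra_simps)

lemma omega_self [simp]: "omega z z = 0"
  by (simp add: omega_def inner_commute)

lemma omega_commute: "omega z w = - omega w z"
  by (simp add: omega_def inner_commute)

lemmas omega_simps = omega_add_left omega_add_right omega_scaleR_left omega_scaleR_right
  omega_diff_left omega_diff_right

lemma omega_rot: "omega (rot z) z = (norm z)\<^sup>2"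
  by (simp add: omega_def rot_def power2_norm_eq_inner inner_prod_def inner_commute)

lemma mem_hplane_iff: "\<eta>' \<in> hplane \<eta> \<longleftrightarrow> hgap \<eta> \<eta>' = 0"
  by (auto simp: hplane_def hgap_def height_def omega_def xi1_def split: prod.splits)

lemma hgap_commute: "hgap \<eta> \<eta>' = - hgap \<eta>' \<eta>"
  using omega_commute[of "xi1 \<eta>" "xi1 \<eta>'"] by (simp add: hgap_def)

lemma tendsto_omega [tendsto_intros]:
  "(f \<longlongrightarrow> a) F \<Longrightarrow> (g \<longlongrightarrow> b) F \<Longrightarrow> ((\<lambda>x. omega (f x) (g x)) \<longlongrightarrow> omega a b) F"
  unfolding omega_def by (intro tendsto_intros)

lemma tendsto_xi1 [tendsto_intros]: "(f \<longlongrightarrow> a) F \<Longrightarrow> ((\<lambda>x. xi1 (f x)) \<longlongrightarrow> xi1 a) F"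
  unfolding xi1_def case_prod_unfold by (intro tendsto_intros)

lemma tendsto_height [tendsto_intros]: "(f \<longlongrightarrow> a) F \<Longrightarrow> ((\<lambda>x. height (f x)) \<longlongrightarrow> height a) F"
  unfolding height_def by (intro tendsto_intros)

lemma tendsto_heis_point [tendsto_intros]:
  "(f \<longlongrightarrow> a) F \<Longrightarrow> (g \<longlongrightarrow> b) F \<Longrightarrow>
    ((\<lambda>x. heis_point (f x) (g x)) \<longlongrightarrow> heis_point a b) F"
  unfolding heis_point_def by (intro tendsto_intros)

lemma tendsto_hgap [tendsto_intros]:
  "(f \<longlongrightarrow> a) F \<Longrightarrow> (g \<longlongrightarrow> b) F \<Longrightarrow> ((\<lambda>x. hgap (f x) (g x)) \<longlongrightarrow> hgap a b) F"
  unfolding hgap_def by (intro tendsto_intros)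

lemma tendsto_rot [tendsto_intros]: "(f \<longlongrightarrow> a) F \<Longrightarrow> ((\<lambda>x. rot (f x)) \<longlongrightarrow> rot a) F"
  unfolding rot_def by (intro tendsto_intros)

section \<open>Monotonicity and maximality in terms of gaps\<close>

lemma smap_dom_UNIV_value: "smap_dom T = UNIV \<Longrightarrow> \<exists>v. v \<in> T \<eta>"
  unfolding smap_dom_def by blast

lemma H_monotone_set_iff:
  "H_monotone_set A \<longleftrightarrow> (\<forall>\<eta> v \<eta>' v'. (\<eta>, v) \<in> A \<longrightarrow> (\<eta>', v') \<in> A \<longrightarrow>
    hgap \<eta> \<eta>' = 0 \<longrightarrow> (xi1 \<eta> - xi1 \<eta>') \<bullet> (v - v') \<ge> 0)"
  unfolding H_monotone_set_def mem_hplane_iff by blast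

lemma mem_smap_graph [simp]: "(\<eta>, v) \<in> smap_graph T \<longleftrightarrow> v \<in> T \<eta>"
  by (simp add: smap_graph_def)

lemma H_monotoneD:
  assumes "H_monotone T" "v \<in> T \<eta>" "v' \<in> T \<eta>'" "hgap \<eta> \<eta>' = 0"
  shows "(xi1 \<eta> - xi1 \<eta>') \<bullet> (v - v') \<ge> 0"
  using assms by (simp add: H_monotone_def H_monotone_set_iff del: split_paired_All)

text \<open>A proper H-monotone extension contains an extension by one pair. Horizontal relatedness
  and the inequality are both symmetric, so one order of the pair is enough.\<close>

lemma maximal_H_monotone_iff:
  assumes mono: "H_monotone T"
  shows "maximal_H_monotone T \<longleftrightarrow>
    (\<forall>\<eta> v. (\<forall>\<eta>' v'. v' \<in> T \<eta>' \<longrightarrow> hgap \<eta> \<eta>' = 0 \<longrightarrow> (xi1 \<eta> - xi1 \<eta>') \<bullet> (v - v') \<ge> 0) \<longrightarrow> v \<in> T \<eta>)"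
    (is "_ = (\<forall>\<eta> v. ?rel \<eta> v \<longrightarrow> _)")
proof
  assume max: "maximal_H_monotone T"
  show "\<forall>\<eta> v. ?rel \<eta> v \<longrightarrow> v \<in> T \<eta>"
  proof (intro allI impI, rule ccontr)
    fix \<eta> v assume rel: "?rel \<eta> v" and notin: "v \<notin> T \<eta>"
    have rel': "(xi1 \<eta>' - xi1 \<eta>) \<bullet> (v' - v) \<ge> 0" if "v' \<in> T \<eta>'" "hgap \<eta>' \<eta> = 0" for \<eta>' v'
    proof -
      have "(xi1 \<eta>' - xi1 \<eta>) \<bullet> (v' - v) = (xi1 \<eta> - xi1 \<eta>') \<bullet> (v - v')"
        by (metis inner_minus_left inner_minus_right minus_diff_eq)
      then show ?thesis
        using rel[rule_format, of v' \<eta>'] that hgap_commute[of \<eta> \<eta>'] by simp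
    qed
    have "H_monotone_set (insert (\<eta>, v) (smap_graph T))"
      unfolding H_monotone_set_iff
    proof (intro allI impI)
      fix \<eta>1 v1 \<eta>2 v2
      assume "(\<eta>1, v1) \<in> insert (\<eta>, v) (smap_graph T)" "(\<eta>2, v2) \<in> insert (\<eta>, v) (smap_graph T)"
        and gap: "hgap \<eta>1 \<eta>2 = 0"
      then consider "\<eta>1 = \<eta>" "v1 = v" "\<eta>2 = \<eta>" "v2 = v" | "\<eta>1 = \<eta>" "v1 = v" "v2 \<in> T \<eta>2"
        | "v1 \<in> T \<eta>1" "\<eta>2 = \<eta>" "v2 = v" | "v1 \<in> T \<eta>1" "v2 \<in> T \<eta>2"
        by (simp only: insert_iff prod.inject mem_smap_graph) blast
      then show "(xi1 \<eta>1 - xi1 \<eta>2) \<bullet> (v1 - v2) \<ge> 0"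
      proof cases
        case 2
        then show ?thesis
          using rel gap by blast
      next
        case 3
        then show ?thesis
          using rel' gap by blast
      next
        case 4
        then show ?thesis
          using H_monotoneD[OF mono] gap by blast
      qed simp
    qed
    moreover have "smap_graph T \<subset> insert (\<eta>, v) (smap_graph T)"
      using notin mem_smap_graph[of \<eta> v T] by blast
    ultimately show False
      using max unfolding maximal_H_monotone_def maximal_H_monotone_set_def by blast
  qed
next
  assume *: "\<forall>\<eta> v. ?rel \<eta> v \<longrightarrow> v \<in> T \<eta>"
  have "B \<subseteq> smap_graph T" if B: "H_monotone_set B" "smap_graph T \<subset> B" for B
  proof
    fix x assume "x \<in> B"
    moreover obtain \<eta> v where x: "x = (\<eta>, v)"
      by (cases x)
    ultimately have "(\<eta>, v) \<in> B"
      by simp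
    moreover have "(\<eta>', v') \<in> B" if "v' \<in> T \<eta>'" for \<eta>' v'
      using that B(2) mem_smap_graph[of \<eta>' v' T] by blast
    ultimately have "?rel \<eta> v"
      using B(1) unfolding H_monotone_set_iff by blast
    then have "v \<in> T \<eta>"
      using * by blast
    then show "x \<in> smap_graph T"
      by (simp add: x)
  qed
  then show "maximal_H_monotone T"
    using mono unfolding maximal_H_monotone_def maximal_H_monotone_set_def H_monotone_def by blast
qed

section \<open>Barycentres and local boundedness\<close>

text \<open>
  The sum of the three gaps is \<open>2 (\<omega>(p, q) + \<omega>(q, \<eta>) + \<omega>(\<eta>, p))\<close>. The weights are the
  solution of the linear equations for a point horizontally related to all three vertices whose
  projection is an affine combination of theirs.
\<close>

lemma hgap_barycenter:
  fixes \<eta> p q :: "'n::finite heisenberg"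
  defines "a \<equiv> hgap p q" and "b \<equiv> hgap q \<eta>" and "c \<equiv> hgap \<eta> p"
  assumes pos: "a + b + c \<noteq> 0"
  defines "z \<equiv> (1 / (a + b + c)) *\<^sub>R (a *\<^sub>R xi1 \<eta> + b *\<^sub>R xi1 p + c *\<^sub>R xi1 q)"
  obtains t where "hgap \<eta> (heis_point z t) = 0" "hgap p (heis_point z t) = 0" "hgap q (heis_point z t) = 0"
proof
  define s where "s = a + b + c"
  let ?t = "height \<eta> + 2 * omega (xi1 \<eta>) z"
  have s0: "s \<noteq> 0"
    using pos by (simp add: s_def)
  have s: "s = 2 * (omega (xi1 p) (xi1 q) + omega (xi1 q) (xi1 \<eta>) + omega (xi1 \<eta>) (xi1 p))"
    by (simp add: s_def a_def b_def c_def hgap_def)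
  have sz: "s * omega w z = a * omega w (xi1 \<eta>) + b * omega w (xi1 p) + c * omega w (xi1 q)" for w
    using s0 by (simp add: z_def s_def[symmetric] omega_simps)
  note comm = omega_commute[of "xi1 \<eta>" "xi1 q"] omega_commute[of "xi1 p" "xi1 \<eta>"] omega_commute[of "xi1 q" "xi1 p"]
  show "hgap \<eta> (heis_point z ?t) = 0"
    by (simp add: hgap_def)
  have "s * hgap p (heis_point z ?t) = s * (height p - height \<eta>) + 2 * (s * omega (xi1 p) z) - 2 * (s * omega (xi1 \<eta>) z)"
    by (simp add: hgap_def algebra_simps)
  also have "\<dots> = 0"
    unfolding sz using comm by (simp add: s a_def b_def c_def hgap_def algebra_simps)
  finally show "hgap p (heis_point z ?t) = 0"
    using s0 by simp
  have "s * hgap q (heis_point z ?t) = s * (height q - height \<eta>) + 2 * (s * omega (xi1 q) z) - 2 * (s * omega (xi1 \<eta>) z)"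
    by (simp add: hgap_def algebra_simps)
  also have "\<dots> = 0"
    unfolding sz using comm by (simp add: s a_def b_def c_def hgap_def algebra_simps)
  finally show "hgap q (heis_point z ?t) = 0"
    using s0 by simp
qed

text \<open>
  The value of \<open>T\<close> at the barycentre cancels, so two fixed points \<open>p\<close>, \<open>q\<close> bound
  \<open>T \<eta>\<close> in one direction even though \<open>\<eta>\<close> is not horizontally related to them.
\<close>

lemma three_point_inequality:
  fixes \<eta> p q :: "'n::finite heisenberg"
  assumes mono: "H_monotone T" and dom: "smap_dom T = UNIV"
  defines "a \<equiv> hgap p q" and "b \<equiv> hgap q \<eta>" and "c \<equiv> hgap \<eta> p"
  assumes pos: "a > 0" "b > 0" "c > 0"
  assumes T: "v \<in> T \<eta>" "v1 \<in> T p" "v2 \<in> T q"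
  defines "z \<equiv> (1 / (a + b + c)) *\<^sub>R (a *\<^sub>R xi1 \<eta> + b *\<^sub>R xi1 p + c *\<^sub>R xi1 q)"
  shows "a * ((z - xi1 \<eta>) \<bullet> v) + b * ((z - xi1 p) \<bullet> v1) + c * ((z - xi1 q) \<bullet> v2) \<le> 0"
proof -
  have "a + b + c \<noteq> 0"
    using pos by simp
  then obtain t where t: "hgap \<eta> (heis_point z t) = 0" "hgap p (heis_point z t) = 0" "hgap q (heis_point z t) = 0"
    by (rule hgap_barycenter[of p q \<eta>, folded a_def b_def c_def, folded z_def])
  obtain w where w: "w \<in> T (heis_point z t)"
    using smap_dom_UNIV_value[OF dom] by blast
  have "(xi1 \<eta> - z) \<bullet> (v - w) \<ge> 0" "(xi1 p - z) \<bullet> (v1 - w) \<ge> 0" "(xi1 q - z) \<bullet> (v2 - w) \<ge> 0"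
    using H_monotoneD[OF mono T(1) w] H_monotoneD[OF mono T(2) w] H_monotoneD[OF mono T(3) w] t by simp_all
  then have "a * ((xi1 \<eta> - z) \<bullet> (v - w)) + b * ((xi1 p - z) \<bullet> (v1 - w)) + c * ((xi1 q - z) \<bullet> (v2 - w)) \<ge> 0"
    using pos by (intro add_nonneg_nonneg mult_nonneg_nonneg) auto
  moreover have "(a + b + c) *\<^sub>R z = a *\<^sub>R xi1 \<eta> + b *\<^sub>R xi1 p + c *\<^sub>R xi1 q"
    using pos by (simp add: z_def)
  then have "(a + b + c) * (z \<bullet> w) = a * (xi1 \<eta> \<bullet> w) + b * (xi1 p \<bullet> w) + c * (xi1 q \<bullet> w)"
    unfolding inner_scaleR_left[symmetric] inner_add_left[symmetric] by (rule arg_cong)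
  moreover have "a * ((xi1 \<eta> - z) \<bullet> (v - w)) + b * ((xi1 p - z) \<bullet> (v1 - w)) + c * ((xi1 q - z) \<bullet> (v2 - w))
    = (a + b + c) * (z \<bullet> w) - (a * (xi1 \<eta> \<bullet> w) + b * (xi1 p \<bullet> w) + c * (xi1 q \<bullet> w))
      - (a * ((z - xi1 \<eta>) \<bullet> v) + b * ((z - xi1 p) \<bullet> v1) + c * ((z - xi1 q) \<bullet> v2))"
    by (simp add: inner_diff_left inner_diff_right algebra_simps)
  ultimately show ?thesis
    by linarith
qed

text \<open>Blow-up argument: if the values were unbounded, their normalizations would accumulate at
  a unit vector \<open>u\<close>. The three-point inequality with fixed \<open>p\<close> and
  \<open>q\<close>, divided by the norms, would then bound a positive multiple of
  \<open>u \<bullet> u\<close> by 0 in the limit.\<close>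

lemma H_monotone_locally_bounded:
  fixes X :: "nat \<Rightarrow> 'n::finite heisenberg"
  assumes mono: "H_monotone T" and dom: "smap_dom T = UNIV"
    and X: "X \<longlonglongrightarrow> \<eta>" and V: "\<And>k. V k \<in> T (X k)"
  shows "Bseq V"
proof (rule ccontr)
  assume nb: "\<not> Bseq V"
  \<comment> \<open>The indices have to grow with the norms, so that \<open>X\<close> still tends to
    \<eta> along them.\<close>
  have "\<exists>k\<ge>m. norm (V k) > real m" for m
  proof (rule ccontr)
    assume "\<not> ?thesis"
    then have "Bseq (\<lambda>k. V (k + m))"
      by (intro BseqI'[of _ "real m"]) (simp add: not_less)
    with nb show False
      by (simp add: Bseq_offset)
  qed
  then obtain r where r: "\<And>m. r m \<ge> m" "\<And>m. norm (V (r m)) > real m"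
    by metis
  have "\<forall>m. V (r m) /\<^sub>R norm (V (r m)) \<in> sphere 0 1"
  proof
    fix m
    have "norm (V (r m)) \<noteq> 0"
      using le_less_trans[OF of_nat_0_le_iff r(2)[of m]] by simp
    then show "V (r m) /\<^sub>R norm (V (r m)) \<in> sphere 0 1"
      by (simp only: mem_sphere_0 norm_scaleR abs_inverse abs_norm_cancel left_inverse not_False_eq_True)
  qed
  then obtain u s where u: "u \<in> sphere 0 1" and s: "strict_mono s"
    and U: "((\<lambda>m. V (r m) /\<^sub>R norm (V (r m))) \<circ> s) \<longlonglongrightarrow> u"
    by (rule seq_compactE[OF compact_imp_seq_compact[OF compact_sphere]])
  define \<rho> where "\<rho> m = r (s m)" for m
  have \<rho>: "m \<le> \<rho> m" "real m < norm (V (\<rho> m))" for m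
    using r[of "s m"] seq_suble[OF s, of m] by (auto simp: \<rho>_def)
  have \<rho>_top: "filterlim \<rho> at_top sequentially"
    using \<rho>(1) by (intro filterlim_at_top_mono[OF filterlim_ident]) simp
  have Y: "(\<lambda>m. X (\<rho> m)) \<longlonglongrightarrow> \<eta>"
    using filterlim_compose[OF X \<rho>_top] .
  have inv0: "(\<lambda>m. inverse (norm (V (\<rho> m)))) \<longlonglongrightarrow> 0"
    by (intro tendsto_inverse_0_at_top filterlim_at_top_mono[OF filterlim_real_sequentially]
        always_eventually allI less_imp_le \<rho>(2))
  \<comment> \<open>\<open>p\<close> and \<open>q\<close> are the left translates by \<open>\<eta>\<close> of \<open>(z1, -1)\<close> and \<open>(z2, 1)\<close>; the \<open>rot\<close> terms make all gaps positive, and the bound obtained at \<open>\<eta>\<close> is in the direction \<open>u\<close>.\<close>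
  define z1 z2 where "z1 = (1/2) *\<^sub>R u + 2 *\<^sub>R rot u" and "z2 = (1/2) *\<^sub>R u - 2 *\<^sub>R rot u"
  define p where "p = heis_point (xi1 \<eta> + z1) (height \<eta> - 1 + 2 * omega (xi1 \<eta>) z1)"
  define q where "q = heis_point (xi1 \<eta> + z2) (height \<eta> + 1 + 2 * omega (xi1 \<eta>) z2)"
  have omega_z: "omega z1 z2 = 2"
    using u omega_rot[of u] omega_commute[of u "rot u"] by (simp add: z1_def z2_def omega_simps)
  have gap: "hgap p q = 2" "hgap q \<eta> = 1" "hgap \<eta> p = 1"
    using omega_z omega_commute[of z1 "xi1 \<eta>"] omega_commute[of z2 "xi1 \<eta>"]
    by (simp_all add: hgap_def p_def q_def omega_simps)
  define a b c where "a = hgap p q" and "b = (\<lambda>m. hgap q (X (\<rho> m)))" and "c = (\<lambda>m. hgap (X (\<rho> m)) p)"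
  have lims: "b \<longlonglongrightarrow> 1" "c \<longlonglongrightarrow> 1"
    using tendsto_hgap[OF tendsto_const Y, of q] tendsto_hgap[OF Y tendsto_const, of p]
    by (simp_all add: gap b_def c_def)
  have a_pos: "a > 0"
    by (simp add: a_def gap)
  define z where "z m = (1 / (a + b m + c m)) *\<^sub>R (a *\<^sub>R xi1 (X (\<rho> m)) + b m *\<^sub>R xi1 p + c m *\<^sub>R xi1 q)" for m
  have "z \<longlonglongrightarrow> (1 / (a + 1 + 1)) *\<^sub>R (a *\<^sub>R xi1 \<eta> + 1 *\<^sub>R xi1 p + 1 *\<^sub>R xi1 q)"
    unfolding z_def by (intro tendsto_intros lims Y) (simp add: a_def gap)
  \<comment> \<open>The limit weights are 2, 1, 1 and \<open>z1 + z2 = u\<close>, hence a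
    displacement from \<open>xi1 \<eta>\<close> by a quarter of \<open>u\<close>.\<close>
  also have "(1 / (a + 1 + 1)) *\<^sub>R (a *\<^sub>R xi1 \<eta> + 1 *\<^sub>R xi1 p + 1 *\<^sub>R xi1 q) = xi1 \<eta> + (1/4) *\<^sub>R u"
  proof -
    have "z1 + z2 = u"
      by (simp add: z1_def z2_def flip: scaleR_add_left)
    moreover have "a *\<^sub>R xi1 \<eta> + 1 *\<^sub>R xi1 p + 1 *\<^sub>R xi1 q = 4 *\<^sub>R xi1 \<eta> + (z1 + z2)"
      using scaleR_add_left[of 2 2 "xi1 \<eta>"] unfolding a_def gap by (simp add: p_def q_def scaleR_2)
    ultimately show ?thesis
      unfolding a_def gap by (simp add: scaleR_add_right)
  qed
  finally have z: "z \<longlonglongrightarrow> xi1 \<eta> + (1/4) *\<^sub>R u" .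
  obtain v1 v2 where v12: "v1 \<in> T p" "v2 \<in> T q"
    using smap_dom_UNIV_value[OF dom] by blast
  \<comment> \<open>\<open>K\<close> collects the terms at \<open>p\<close> and \<open>q\<close>. It
    converges, so division by the norms of \<open>V\<close> makes it vanish.\<close>
  define K where "K m = - (b m * ((z m - xi1 p) \<bullet> v1)) - c m * ((z m - xi1 q) \<bullet> v2)" for m
  have "K \<longlonglongrightarrow> - (1 * ((xi1 \<eta> + (1/4) *\<^sub>R u - xi1 p) \<bullet> v1)) - 1 * ((xi1 \<eta> + (1/4) *\<^sub>R u - xi1 q) \<bullet> v2)"
    unfolding K_def by (intro tendsto_intros lims z)
  from tendsto_mult[OF inv0 this]
  have K0: "(\<lambda>m. inverse (norm (V (\<rho> m))) * K m) \<longlonglongrightarrow> 0"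
    by (simp only: mult_zero_left)
  have "\<forall>\<^sub>F m in sequentially. b m > 0" "\<forall>\<^sub>F m in sequentially. c m > 0"
    using lims by (auto intro: order_tendstoD)
  then have "\<forall>\<^sub>F m in sequentially.
    a * ((z m - xi1 (X (\<rho> m))) \<bullet> (V (\<rho> m) /\<^sub>R norm (V (\<rho> m)))) \<le> inverse (norm (V (\<rho> m))) * K m"
  proof eventually_elim
    case (elim m)
    have "a * ((z m - xi1 (X (\<rho> m))) \<bullet> V (\<rho> m)) \<le> K m"
      using three_point_inequality[OF mono dom _ _ _ V v12, of "\<rho> m"] elim a_pos
      unfolding K_def a_def b_def c_def z_def by linarith
    then have "inverse (norm (V (\<rho> m))) * (a * ((z m - xi1 (X (\<rho> m))) \<bullet> V (\<rho> m))) \<le> inverse (norm (V (\<rho> m))) * K m"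
      by (intro mult_left_mono) simp_all
    then show ?case
      by (simp add: mult.left_commute)
  qed
  moreover have "(\<lambda>m. a * ((z m - xi1 (X (\<rho> m))) \<bullet> (V (\<rho> m) /\<^sub>R norm (V (\<rho> m)))))
      \<longlonglongrightarrow> a * ((xi1 \<eta> + (1/4) *\<^sub>R u - xi1 \<eta>) \<bullet> u)"
    using U by (intro tendsto_intros z Y) (simp add: o_def \<rho>_def)
  ultimately have "a * ((xi1 \<eta> + (1/4) *\<^sub>R u - xi1 \<eta>) \<bullet> u) \<le> 0"
    using K0 by (intro tendsto_le[OF sequentially_bot]) auto
  then show False
    using u by (simp add: a_def gap dot_square_norm)
qed

section \<open>Limits of monotonicity inequalities\<close>

lemma tendsto_inner_Bseq:
  fixes f g :: "nat \<Rightarrow> 'a::real_inner"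
  assumes "f \<longlonglongrightarrow> 0" "Bseq g"
  shows "(\<lambda>k. f k \<bullet> g k) \<longlonglongrightarrow> 0"
  using bounded_bilinear.Zfun_prod_Bfun[OF bounded_bilinear_inner, of f sequentially g] assms
  by (simp add: tendsto_Zfun_iff)

text \<open>\<open>X k\<close> and \<open>\<eta>'\<close> need not be horizontally related, so
  monotonicity is used twice, through a point near their midpoint. The value there has nearly
  opposite coefficients in the two inequalities, and local boundedness makes its contribution
  vanish.\<close>

lemma H_monotone_limit:
  fixes X :: "nat \<Rightarrow> 'n::finite heisenberg"
  assumes mono: "H_monotone T" and dom: "smap_dom T = UNIV"
    and X: "X \<longlonglongrightarrow> \<eta>" and V: "\<And>k. V k \<in> T (X k)"
    and v': "v' \<in> T \<eta>'" and gap: "hgap \<eta> \<eta>' = 0"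
    and B: "\<And>k. (xi1 \<eta> - xi1 \<eta>') \<bullet> V k \<le> B k" "B \<longlonglongrightarrow> \<beta>"
  shows "(xi1 \<eta> - xi1 \<eta>') \<bullet> v' \<le> \<beta>"
proof (cases "xi1 \<eta> = xi1 \<eta>'")
  case True
  then show ?thesis
    using B by (auto intro: LIMSEQ_le_const)
next
  case False
  let ?u = "xi1 \<eta> - xi1 \<eta>'"
  \<comment> \<open>\<open>z k\<close> corrects the midpoint so that \<open>\<zeta> k\<close> lies on the horizontal planes of both \<open>X k\<close> and \<open>\<eta>'\<close>.\<close>
  define d where "d k = xi1 (X k) - xi1 \<eta>'" for k
  define s where "s k = hgap (X k) \<eta>' / (2 * (norm (d k))\<^sup>2)" for k
  define z where "z k = (1/2) *\<^sub>R (xi1 (X k) + xi1 \<eta>') + s k *\<^sub>R rot (d k)" for k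
  define \<zeta> where "\<zeta> k = heis_point (z k) (height \<eta>' + 2 * omega (xi1 \<eta>') (z k))" for k
  have d: "d \<longlonglongrightarrow> ?u"
    unfolding d_def by (intro tendsto_intros X)
  have "s \<longlonglongrightarrow> hgap \<eta> \<eta>' / (2 * (norm ?u)\<^sup>2)"
    unfolding s_def by (intro tendsto_intros X d) (use False in simp)
  then have s: "s \<longlonglongrightarrow> 0"
    by (simp add: gap)
  have "z \<longlonglongrightarrow> (1/2) *\<^sub>R (xi1 \<eta> + xi1 \<eta>') + 0 *\<^sub>R rot ?u"
    unfolding z_def by (intro tendsto_intros X s d)
  then have z: "z \<longlonglongrightarrow> (1/2) *\<^sub>R (xi1 \<eta> + xi1 \<eta>')"
    by simp
  have \<zeta>: "\<zeta> \<longlonglongrightarrow> heis_point ((1/2) *\<^sub>R (xi1 \<eta> + xi1 \<eta>'))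
      (height \<eta>' + 2 * omega (xi1 \<eta>') ((1/2) *\<^sub>R (xi1 \<eta> + xi1 \<eta>')))"
    unfolding \<zeta>_def by (intro tendsto_intros z)
  have "\<forall>k. \<exists>w. w \<in> T (\<zeta> k)"
    using smap_dom_UNIV_value[OF dom] by blast
  then obtain W where W: "\<And>k. W k \<in> T (\<zeta> k)"
    by (rule choice[THEN exE]) blast
  have bdd: "Bseq V" "Bseq W"
    by (rule H_monotone_locally_bounded[OF mono dom X V], rule H_monotone_locally_bounded[OF mono dom \<zeta> W])
  have gap1: "hgap (\<zeta> k) \<eta>' = 0" for k
    using omega_commute[of "z k" "xi1 \<eta>'"] by (simp add: \<zeta>_def hgap_def)
  have gap2: "hgap (X k) (\<zeta> k) = 0" if "d k \<noteq> 0" for k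
  proof -
    have "hgap (X k) (\<zeta> k) = height (X k) - height \<eta>' + 2 * omega (d k) (z k)"
      by (simp add: \<zeta>_def hgap_def d_def omega_simps)
    also have "omega (d k) (z k) = omega (xi1 (X k)) (xi1 \<eta>') - s k * (norm (d k))\<^sup>2"
      using omega_commute[of "xi1 \<eta>'" "xi1 (X k)"] omega_commute[of "d k" "rot (d k)"] omega_rot[of "d k"]
      unfolding z_def by (simp add: omega_add_right omega_scaleR_right) (simp add: d_def omega_simps)
    \<comment> \<open>The \<open>rot\<close> shift lowers the gap by
      \<open>2 * (s k * (norm (d k))\<^sup>2)\<close>; \<open>s k\<close> is chosen to cancel it
      exactly.\<close>
    finally have "hgap (X k) (\<zeta> k) = hgap (X k) \<eta>' - 2 * (s k * (norm (d k))\<^sup>2)"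
      by (simp add: hgap_def[of _ \<eta>'])
    then show ?thesis
      using that by (simp add: s_def)
  qed
  \<comment> \<open>\<open>\<epsilon> k\<close> is the net coefficient of \<open>W k\<close> in the
    sum of the two inequalities, \<open>\<delta> k\<close> the deviation of the coefficient of
    \<open>V k\<close> from half of \<open>?u\<close>. Both tend to 0, while \<open>V\<close> and
    \<open>W\<close> are only known to be bounded.\<close>
  define \<delta> where "\<delta> k = xi1 (X k) - z k - (1/2) *\<^sub>R ?u" for k
  define \<epsilon> where "\<epsilon> k = 2 *\<^sub>R z k - xi1 (X k) - xi1 \<eta>'" for k
  have "\<delta> \<longlonglongrightarrow> xi1 \<eta> - (1/2) *\<^sub>R (xi1 \<eta> + xi1 \<eta>') - (1/2) *\<^sub>R ?u"
    "\<epsilon> \<longlonglongrightarrow> 2 *\<^sub>R ((1/2) *\<^sub>R (xi1 \<eta> + xi1 \<eta>')) - xi1 \<eta> - xi1 \<eta>'"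
    unfolding \<delta>_def \<epsilon>_def by (intro tendsto_intros X z)+
  moreover have "xi1 \<eta> - (1/2) *\<^sub>R (xi1 \<eta> + xi1 \<eta>') - (1/2) *\<^sub>R ?u = 0"
    by (simp add: diff_diff_eq scaleR_2 flip: scaleR_add_right)
  ultimately have "\<delta> \<longlonglongrightarrow> 0" "\<epsilon> \<longlonglongrightarrow> 0"
    by simp_all
  then have null: "(\<lambda>k. \<delta> k \<bullet> V k) \<longlonglongrightarrow> 0" "(\<lambda>k. \<epsilon> k \<bullet> W k) \<longlonglongrightarrow> 0"
    using bdd by (auto intro: tendsto_inner_Bseq)
  have "\<forall>\<^sub>F k in sequentially. d k \<noteq> 0"
    using d False by (auto intro: tendsto_imp_eventually_ne)
  then have "\<forall>\<^sub>F k in sequentially. (z k - xi1 \<eta>') \<bullet> v' \<le> B k / 2 + \<delta> k \<bullet> V k + \<epsilon> k \<bullet> W k"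
  proof eventually_elim
    case (elim k)
    have "(xi1 (X k) - z k) \<bullet> (V k - W k) \<ge> 0" "(z k - xi1 \<eta>') \<bullet> (W k - v') \<ge> 0"
      using H_monotoneD[OF mono V W gap2[OF elim]] H_monotoneD[OF mono W v' gap1]
      by (simp_all add: \<zeta>_def)
    moreover have "(xi1 (X k) - z k) \<bullet> V k = (?u \<bullet> V k) / 2 + \<delta> k \<bullet> V k"
      by (simp add: \<delta>_def inner_diff_left)
    moreover have "\<epsilon> k \<bullet> W k = (z k - xi1 \<eta>') \<bullet> W k - (xi1 (X k) - z k) \<bullet> W k"
      by (simp add: \<epsilon>_def inner_diff_left)
    ultimately show ?case
      using B(1)[of k] unfolding inner_diff_right by linarith
  qed
  moreover have "(\<lambda>k. (z k - xi1 \<eta>') \<bullet> v') \<longlonglongrightarrow> ((1/2) *\<^sub>R (xi1 \<eta> + xi1 \<eta>') - xi1 \<eta>') \<bullet> v'"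
    by (intro tendsto_intros z)
  moreover have "(\<lambda>k. B k / 2 + \<delta> k \<bullet> V k + \<epsilon> k \<bullet> W k) \<longlonglongrightarrow> \<beta> / 2 + 0 + 0"
    by (intro tendsto_add tendsto_divide tendsto_const B(2) null) simp
  ultimately have "((1/2) *\<^sub>R (xi1 \<eta> + xi1 \<eta>') - xi1 \<eta>') \<bullet> v' \<le> \<beta> / 2 + 0 + 0"
    by (intro tendsto_le[OF sequentially_bot])
  then show ?thesis
    by (simp add: inner_diff_left inner_add_left field_simps)
qed

section \<open>The two implications\<close>

lemma maximal_imp_surj:
  fixes T :: "'n::finite heisenberg \<Rightarrow> 'n layer1 set"
  assumes mono: "H_monotone T" and dom: "smap_dom T = UNIV"
    and max: "maximal_H_monotone T" and lam: "lam > 0"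
  shows "smap_surj_on (xi1_plus lam T) (hplane \<eta>0)"
  unfolding smap_surj_on_def
proof
  fix p :: "'n layer1"
  define P where "P z = heis_point z (height \<eta>0 + 2 * omega (xi1 \<eta>0) z)" for z
  have gapP: "hgap \<eta>0 (P z) = 0" and xiP: "xi1 (P z) = z" for z
    by (simp_all add: P_def hgap_def)
  have "\<forall>z. \<exists>v. v \<in> T (P z)"
    using smap_dom_UNIV_value[OF dom] by blast
  then obtain \<tau> where \<tau>: "\<And>z. \<tau> z \<in> T (P z)"
    by (rule choice[THEN exE]) blast
  define f where "f z = z + lam *\<^sub>R \<tau> z - p" for z
  define z0 where "z0 = xi1 \<eta>0"
  have P0: "P z0 = \<eta>0"
    by (simp add: P_def z0_def)
  \<comment> \<open>With \<open>R\<close> at least \<open>norm (f z0)\<close>, the quadratic term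
    \<open>R * R\<close> absorbs the linear one on the sphere; the summand 1 keeps \<open>R\<close>
    positive.\<close>
  define R where "R = norm (f z0) + 1"
  have "R > 0"
    by (simp add: R_def add_nonneg_pos)
  moreover have "(z - z0) \<bullet> f z \<ge> 0" if "dist z0 z = R" for z
  proof -
    have n: "norm (z - z0) = R"
      using that by (simp add: dist_norm norm_minus_commute)
    have "(z0 - z) \<bullet> (\<tau> z0 - \<tau> z) \<ge> 0"
      using H_monotoneD[OF mono \<tau>[of z0] \<tau>[of z]] gapP[of z] xiP[of z] unfolding P0 by (simp add: z0_def)
    then have "lam * ((z0 - z) \<bullet> (\<tau> z0 - \<tau> z)) \<ge> 0"
      using lam by simp
    moreover have "(z - z0) \<bullet> f z = (z - z0) \<bullet> (z - z0) + lam * ((z0 - z) \<bullet> (\<tau> z0 - \<tau> z)) + (z - z0) \<bullet> f z0"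
      by (simp add: f_def inner_simps algebra_simps)
    moreover have "\<bar>(z - z0) \<bullet> f z0\<bar> \<le> R * norm (f z0)"
      using Cauchy_Schwarz_ineq2[of "z - z0" "f z0"] by (simp add: n)
    moreover have "R * norm (f z0) \<le> R * R"
      using \<open>R > 0\<close> by (intro mult_left_mono) (simp_all add: R_def)
    moreover have "(z - z0) \<bullet> (z - z0) = R * R"
      by (simp add: dot_square_norm n power2_eq_square)
    ultimately show ?thesis
      by linarith
  qed
  ultimately obtain z where z: "\<And>u e. e > 0 \<Longrightarrow> \<exists>z'\<in>ball z e. u \<bullet> f z' \<le> 0"
    using brouwer_separation by metis
  \<comment> \<open>The only value at \<open>P z\<close> that solves the inclusion for
    \<open>p\<close>; it remains to relate it monotonically to the graph.\<close>
  define w where "w = (1 / lam) *\<^sub>R (p - z)"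
  have "w \<in> T (P z)"
  proof (rule maximal_H_monotone_iff[OF mono, THEN iffD1, OF max, rule_format])
    fix \<eta>' v' assume v': "v' \<in> T \<eta>'" and gap: "hgap (P z) \<eta>' = 0"
    let ?u = "z - xi1 \<eta>'"
    \<comment> \<open>The direction depends on \<open>\<eta>'\<close>, so each graph point gets its
      own sequence \<open>Z\<close> tending to \<open>z\<close>.\<close>
    have "\<exists>z'. dist z z' < inverse (real (Suc k)) \<and> ?u \<bullet> f z' \<le> 0" for k
      using z[of "inverse (real (Suc k))" ?u, OF positive_imp_inverse_positive[OF of_nat_0_less_iff[THEN iffD2, OF zero_less_Suc]]]
      unfolding Bex_def mem_ball .
    then have "\<forall>k. \<exists>z'. dist z z' < inverse (real (Suc k)) \<and> ?u \<bullet> f z' \<le> 0"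
      by blast
    from choice[OF this]
    obtain Z where Z: "\<And>k. dist z (Z k) < inverse (real (Suc k))" "\<And>k. ?u \<bullet> f (Z k) \<le> 0"
      by blast
    have "dist (Z k) z \<le> inverse (real (Suc k))" for k
      using Z(1)[of k] unfolding dist_commute[of z] by (rule less_imp_le)
    then have "(\<lambda>k. dist (Z k) z) \<longlonglongrightarrow> 0"
      by (intro tendsto_sandwich[OF always_eventually always_eventually tendsto_const
            LIMSEQ_inverse_real_of_nat] allI zero_le_dist)
    then have Zlim: "Z \<longlonglongrightarrow> z"
      by (rule tendsto_dist_iff[THEN iffD2])
    have "(\<lambda>k. P (Z k)) \<longlonglongrightarrow> P z"
      unfolding P_def by (intro tendsto_intros Zlim)
    moreover have "(xi1 (P z) - xi1 \<eta>') \<bullet> \<tau> (Z k) \<le> ?u \<bullet> ((1 / lam) *\<^sub>R (p - Z k))" for k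
    proof -
      have "lam * (?u \<bullet> \<tau> (Z k)) \<le> ?u \<bullet> (p - Z k)"
        using Z(2)[of k] unfolding f_def inner_add_right inner_diff_right inner_scaleR_right by linarith
      then show ?thesis
        using lam by (simp only: xiP inner_scaleR_right) (simp add: pos_le_divide_eq mult.commute)
    qed
    moreover have "(\<lambda>k. ?u \<bullet> ((1 / lam) *\<^sub>R (p - Z k))) \<longlonglongrightarrow> ?u \<bullet> w"
      unfolding w_def by (intro tendsto_intros Zlim)
    ultimately have "(xi1 (P z) - xi1 \<eta>') \<bullet> v' \<le> ?u \<bullet> w"
      by (rule H_monotone_limit[OF mono dom _ \<tau> v' gap])
    then show "(xi1 (P z) - xi1 \<eta>') \<bullet> (w - v') \<ge> 0"
      by (simp add: xiP inner_diff_right)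
  qed
  moreover have "p = xi1 (P z) + lam *\<^sub>R w"
    using lam by (simp add: w_def xiP)
  ultimately have "p \<in> xi1_plus lam T (P z)"
    unfolding xi1_plus_def by blast
  then show "\<exists>\<eta>'\<in>hplane \<eta>0. p \<in> xi1_plus lam T \<eta>'"
    using gapP[of z] by (intro bexI[of _ "P z"]) (simp_all add: mem_hplane_iff)
qed

text \<open>Minty's argument: solving the inclusion for \<open>xi1 \<eta> + v\<close> on the plane
  through \<eta> itself makes the solution horizontally related to \<eta>, so \<open>rel\<close>
  applies and forces the projections to agree.\<close>

lemma surj_imp_maximal:
  fixes T :: "'n::finite heisenberg \<Rightarrow> 'n layer1 set"
  assumes mono: "H_monotone T" and surj: "\<And>\<eta>. smap_surj_on (xi1_plus 1 T) (hplane \<eta>)"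
  shows "maximal_H_monotone T"
  unfolding maximal_H_monotone_iff[OF mono]
proof (intro allI impI)
  fix \<eta> v
  assume rel: "\<forall>\<eta>' v'. v' \<in> T \<eta>' \<longrightarrow> hgap \<eta> \<eta>' = 0 \<longrightarrow> (xi1 \<eta> - xi1 \<eta>') \<bullet> (v - v') \<ge> 0"
  obtain \<eta>' v' where *: "hgap \<eta> \<eta>' = 0" "v' \<in> T \<eta>'" "xi1 \<eta> + v = xi1 \<eta>' + v'"
  proof -
    obtain \<eta>' where "\<eta>' \<in> hplane \<eta>" "xi1 \<eta> + v \<in> xi1_plus 1 T \<eta>'"
      using surj[of \<eta>] unfolding smap_surj_on_def by blast
    moreover from this obtain v' where "v' \<in> T \<eta>'" "xi1 \<eta> + v = xi1 \<eta>' + 1 *\<^sub>R v'"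
      unfolding xi1_plus_def by blast
    ultimately show ?thesis
      using that[of \<eta>' v'] by (simp only: mem_hplane_iff scaleR_one)
  qed
  then have "v - v' = - (xi1 \<eta> - xi1 \<eta>')"
    by (simp add: algebra_simps)
  with rel * have "(xi1 \<eta> - xi1 \<eta>') \<bullet> - (xi1 \<eta> - xi1 \<eta>') \<ge> 0"
    by metis
  then have "\<not> (xi1 \<eta> - xi1 \<eta>') \<bullet> (xi1 \<eta> - xi1 \<eta>') > 0"
    by (simp only: inner_minus_right)
  then have xi: "xi1 \<eta> = xi1 \<eta>'"
    by (simp only: inner_gt_zero_iff right_minus_eq not_not)
  \<comment> \<open>For equal projections the gap is just the difference of the heights.\<close>
  with * have "height \<eta> = height \<eta>'"
    by (simp add: hgap_def)
  with xi have "\<eta> = \<eta>'"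
    by (metis heis_point_xi1_height)
  with * xi show "v \<in> T \<eta>"
    by simp
qed

theorem theorem1p2:
  fixes T :: "'n::finite heisenberg \<Rightarrow> 'n layer1 set"
  assumes "H_monotone T"
    and "smap_dom T = UNIV"
  shows "maximal_H_monotone T \<longleftrightarrow>
    (\<forall>\<eta>. \<forall>lam>0. smap_surj_on (xi1_plus lam T) (hplane \<eta>))"
  using maximal_imp_surj[OF assms] surj_imp_maximal[OF assms(1)] by auto

end
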